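(* Let $\mathcal{M}=\{1^{m_1},\ldots,n^{m_n}\}$ with all $m_i\ge1$, $M=m_1+\cdots+m_n$ and $k=M-n+1$. There exist bijections $\psi_1:\mathcal{UT}_{\mathcal{M}}\to\mathcal{UG}_{\mathcal{M}}$ and $\psi_2:\mathcal{UG}_{\mathcal{M}}\to\mathcal{UB}_{n,k}$ such that, for every $T\in\mathcal{UT}_{\mathcal{M}}$, with $G=\psi_1(T)$ and $\Pi=\psi_2(G)=(\pi^{(0)},\ldots,\pi^{(k-1)})$, and for every $i\in\{0,1,\ldots,M-n\}$, the following three quantities are equal: the number of distinct labels among edges ending at the vertex labeled $i$ in $T$; the number of distinct labels among edges ending at the vertex labeled $i$ in $G$; and the number of integers in the block $\pi^{(i)}$.
   Context: Labeling conditions for a directed graph whose edges and vertices are labeled (an edge $u\to v$ "starts at $u$ and ends at $v$"; edges ending at a common vertex are sibling edges): (1) vertex labels are distinct and form exactly $\{0,1,\ldots,M-n\}\cup\{s_i:m_i=1\}$ ($s_i$ formal symbols); (2) a vertex has label $s_i$ iff it is a leaf (no incoming edges) whose outgoing edge has label $i$; (3) edge labels form exactly the multiset in which each $i$ with $m_i>1$ appears $m_i-1$ times and each $i$ with $m_i=1$ appears once, and equally labeled edges are sibling edges; (4) equally labeled edges have starting vertices whose labels increase along their order (in the unordered setting this just ties labels together), and for two edges with labels $e_1\ne e_2$ starting at integer-labeled vertices $v_1,v_2$, $e_1<e_2$ iff $v_1<v_2$. $\mathcal{UT}_{\mathcal{M}}$: unordered rooted trees with $M-\#\{i:m_i>1\}$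 edges, all edges directed toward the root, satisfying conditions (1)–(4), where the order among sibling edges is ignored. $\mathcal{UG}_{\mathcal{M}}$: directed graphs satisfying (1)–(4), with order among sibling edges ignored, in which the vertex labeled $0$ has outdegree $0$ and every other vertex has outdegree $1$ (loops and cycles allowed). $\mathcal{UB}_{n,k}$: $k$-tuples $(\pi^{(0)},\ldots,\pi^{(k-1)})$ of (possibly empty) subsets of $[n]$ forming a set partition of $[n]$. *)

theory Defs
  imports "Graph_Theory.Graph_Theory" "HOL-Library.Multiset"
begin

text \<open>
  The multiset \<open>{1^m_1, ..., n^m_n}\<close> is given by \<open>n\<close> and the multiplicities \<open>m i\<close> for
  \<open>i \<in> {1..n}\<close>; the values of \<open>m\<close> outside \<open>{1..n}\<close> play no role.
\<close>

definition total_mult :: "nat \<Rightarrow> (nat \<Rightarrow> nat) \<Rightarrow> nat" where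
  "total_mult n m = (\<Sum>i=1..n. m i)"

text \<open>\<open>Sym i\<close> is the formal symbol \<open>s_i\<close>.\<close>

datatype vlabel = Num nat | Sym nat

text \<open>
  Vertex labels are distinct, so a vertex is identified with its label. An edge is identified
  with the triple (starting vertex, edge label, ending vertex), and \<open>tail\<close> and \<open>head\<close> are
  required to be the projections. Hence two graphs, with no order on sibling edges, are equal
  iff they are isomorphic as labeled graphs. The triples rule out only parallel edges with the
  same label; no parallel edges occur in a tree or where outdegrees are at most 1.
\<close>

type_synonym edge = "vlabel \<times> nat \<times> vlabel"

type_synonym lgraph = "(vlabel, edge) pre_digraph"

fun edge_start :: "edge \<Rightarrow> vlabel" where
  "edge_start (u, l, v) = u"

fun edge_label :: "edge \<Rightarrow> nat" where
  "edge_label (u, l, v) = l"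

fun edge_end :: "edge \<Rightarrow> vlabel" where
  "edge_end (u, l, v) = v"

definition labeled_digraph :: "lgraph \<Rightarrow> bool" where
  "labeled_digraph G \<longleftrightarrow> fin_digraph G \<and> tail G = edge_start \<and> head G = edge_end"

definition leaf :: "lgraph \<Rightarrow> vlabel \<Rightarrow> bool" where
  "leaf G v \<longleftrightarrow> v \<in> verts G \<and> in_arcs G v = {}"

definition vertex_label_cond :: "nat \<Rightarrow> (nat \<Rightarrow> nat) \<Rightarrow> lgraph \<Rightarrow> bool" where
  "vertex_label_cond n m G \<longleftrightarrow>
     verts G = Num ` {0..total_mult n m - n} \<union> Sym ` {i \<in> {1..n}. m i = 1}"

text \<open>
  The condition concerns only the symbols that exist, i.e. those with \<open>m i = 1\<close>: a leaf whose
  outgoing edge has a label of multiplicity greater than 1 carries an integer label.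
\<close>

definition symbol_cond :: "nat \<Rightarrow> (nat \<Rightarrow> nat) \<Rightarrow> lgraph \<Rightarrow> bool" where
  "symbol_cond n m G \<longleftrightarrow>
     (\<forall>i\<in>{1..n}. m i = 1 \<longrightarrow>
        (\<forall>v\<in>verts G. v = Sym i \<longleftrightarrow> leaf G v \<and> (\<exists>e\<in>out_arcs G v. edge_label e = i)))"

definition edge_label_cond :: "nat \<Rightarrow> (nat \<Rightarrow> nat) \<Rightarrow> lgraph \<Rightarrow> bool" where
  "edge_label_cond n m G \<longleftrightarrow>
     image_mset edge_label (mset_set (arcs G)) =
       (\<Sum>i\<in>{1..n}. replicate_mset (if m i > 1 then m i - 1 else 1) i) \<and>
     (\<forall>e\<in>arcs G. \<forall>e'\<in>arcs G. edge_label e = edge_label e' \<longrightarrow> head G e = head G e')"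

text \<open>
  The requirement that the starting vertices of equally labeled edges increase along the order
  of these edges is void without an order on siblings: the edges can always be listed that way.
\<close>

definition order_cond :: "lgraph \<Rightarrow> bool" where
  "order_cond G \<longleftrightarrow>
     (\<forall>e\<in>arcs G. \<forall>e'\<in>arcs G. \<forall>v v'.
        edge_label e \<noteq> edge_label e' \<and> tail G e = Num v \<and> tail G e' = Num v' \<longrightarrow>
          (edge_label e < edge_label e' \<longleftrightarrow> v < v'))"

definition labeling_conds :: "nat \<Rightarrow> (nat \<Rightarrow> nat) \<Rightarrow> lgraph \<Rightarrow> bool" where
  "labeling_conds n m G \<longleftrightarrow>
     vertex_label_cond n m G \<and> symbol_cond n m G \<and> edge_label_cond n m G \<and> order_cond G"

text \<open>
  Rooted trees with all edges directed toward the root: from every vertex there is exactly one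
  directed walk to the root. (\<open>tree\<close> of the library excludes only directed cycles.)
\<close>

definition rooted_in_tree :: "('a, 'b) pre_digraph \<Rightarrow> 'a \<Rightarrow> bool" where
  "rooted_in_tree G r \<longleftrightarrow>
     fin_digraph G \<and> r \<in> verts G \<and> (\<forall>v\<in>verts G. \<exists>!p. pre_digraph.awalk G v p r)"

text \<open>The root, which may be any vertex, is determined by the directions of the edges.\<close>

definition UT :: "nat \<Rightarrow> (nat \<Rightarrow> nat) \<Rightarrow> lgraph set" where
  "UT n m = {T. labeled_digraph T \<and> (\<exists>r. rooted_in_tree T r) \<and>
     card (arcs T) = total_mult n m - card {i \<in> {1..n}. m i > 1} \<and>
     labeling_conds n m T}"

definition UG :: "nat \<Rightarrow> (nat \<Rightarrow> nat) \<Rightarrow> lgraph set" where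
  "UG n m = {G. labeled_digraph G \<and> labeling_conds n m G \<and>
     out_degree G (Num 0) = 0 \<and>
     (\<forall>v\<in>verts G. v \<noteq> Num 0 \<longrightarrow> out_degree G v = 1)}"

definition UB :: "nat \<Rightarrow> nat \<Rightarrow> nat set list set" where
  "UB n k = {bs. length bs = k \<and> (\<Union>j<k. bs ! j) = {1..n} \<and>
     (\<forall>i<k. \<forall>j<k. i \<noteq> j \<longrightarrow> bs ! i \<inter> bs ! j = {})}"

definition num_in_labels :: "lgraph \<Rightarrow> vlabel \<Rightarrow> nat" where
  "num_in_labels G v = card (edge_label ` in_arcs G v)"

end

theory Submission
  imports Defs "HOL-Combinatorics.Multiset_Permutations"
begin

text \<open>
  If every vertex except \<open>Num r\<close> has outdegree 1 and \<open>Num r\<close> has outdegree 0, the labeling conditions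
  determine the label of the edge that starts at each vertex, so that the graph is determined by \<open>r\<close>
  and the map \<open>f\<close> taking a label to the common end of the edges with that label; \<open>f\<close> is an arbitrary
  map from \<open>{1..n}\<close> to \<open>{0..M - n}\<close>. For \<open>r = 0\<close> this gives the graphs, and the fibres of \<open>f\<close> give the
  set partition. The trees are the pairs \<open>(r, f)\<close> in which every label leads to \<open>r\<close>. All three
  statistics are fibre sizes of \<open>f\<close>, so it suffices to show that for every multiset \<open>c\<close> of values
  there are as many trees as maps. As in the theory of Pruefer codes, the trees with root \<open>r\<close> and
  values \<open>c\<close> are equinumerous with the permutations of \<open>c\<close> that end in \<open>r\<close>; summing over \<open>r\<close> gives
  all permutations of \<open>c\<close>, that is, all maps with values \<open>c\<close>.
\<close>

subsection \<open>Counting arborescences with prescribed values\<close>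

text \<open>Bijections between corresponding fibres of \<open>s\<close> and \<open>t\<close> glue
  together. This turns equal counts into a bijection that carries one statistic to the
  other.\<close>

lemma bij_betw_of_card_fibres:
  assumes "finite A" "finite B"
    and "\<And>c. card {a \<in> A. s a = c} = card {b \<in> B. t b = c}"
  shows "\<exists>h. bij_betw h A B \<and> (\<forall>a\<in>A. t (h a) = s a)"
proof -
  have "\<exists>h. bij_betw h {a \<in> A. s a = c} {b \<in> B. t b = c}" for c
    using assms by (intro finite_same_card_bij) auto
  then obtain h where h: "\<And>c. bij_betw (h c) {a \<in> A. s a = c} {b \<in> B. t b = c}"
    by metis
  have hB: "h (s a) a \<in> B" "t (h (s a) a) = s a" if "a \<in> A" for a
    using bij_betwE[OF h[of "s a"]] that by auto
  have "bij_betw (\<lambda>a. h (s a) a) A B"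
    unfolding bij_betw_def
  proof (intro conjI inj_onI equalityI subsetI)
    fix a a' assume a: "a \<in> A" "a' \<in> A" "h (s a) a = h (s a') a'"
    then have "s a = s a'" using hB by metis
    then show "a = a'"
      using a bij_betw_imp_inj_on[OF h[of "s a"]] by (auto dest: inj_onD)
  next
    fix b assume "b \<in> B"
    then have "b \<in> h (t b) ` {a \<in> A. s a = t b}"
      using bij_betw_imp_surj_on[OF h[of "t b"]] by auto
    then show "b \<in> (\<lambda>a. h (s a) a) ` A" by force
  qed (use hB in auto)
  with hB show ?thesis by blast
qed

section \<open>Maps with a prescribed multiset of values\<close>

definition funs_with_values :: "'l set \<Rightarrow> 'v multiset \<Rightarrow> ('l \<Rightarrow> 'v) set" where
  "funs_with_values L c = {f \<in> extensional L. image_mset f (mset_set L) = c}"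

lemma funs_with_values_empty: "funs_with_values {} c = (if c = {#} then {\<lambda>_. undefined} else {})"
  by (auto simp: funs_with_values_def)

lemma funs_with_values_in:
  assumes "finite L" "f \<in> funs_with_values L c" "i \<in> L"
  shows "f i \<in># c"
  using assms by (auto simp: funs_with_values_def)

lemma finite_funs_with_values:
  assumes "finite L" shows "finite (funs_with_values L c)"
proof (rule finite_subset)
  show "funs_with_values L c \<subseteq> L \<rightarrow>\<^sub>E set_mset c"
    using funs_with_values_in[OF assms] by (auto simp: funs_with_values_def PiE_def)
qed (simp add: finite_PiE assms)

text \<open>Splitting off the value at \<open>i\<close> is reversible because extensionality on
  \<open>L\<close> forces \<open>g i = undefined\<close>.\<close>

lemma bij_betw_funs_with_values_insert:
  assumes "finite L" "i \<notin> L"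
  shows "bij_betw (\<lambda>(v, g). g(i := v))
    (SIGMA v:set_mset c. funs_with_values L (c - {#v#})) (funs_with_values (insert i L) c)"
proof (rule bij_betw_byWitness[where f' = "\<lambda>f. (f i, f(i := undefined))"])
  have upd: "image_mset (g(i := v)) (mset_set L) = image_mset g (mset_set L)"
    for g :: "'a \<Rightarrow> 'b" and v
    using assms by (intro image_mset_cong) auto
  show "\<forall>a\<in>SIGMA v:set_mset c. funs_with_values L (c - {#v#}).
       (\<lambda>f. (f i, f(i := undefined))) (case a of (v, g) \<Rightarrow> g(i := v)) = a"
    using assms by (auto simp: funs_with_values_def extensional_def fun_eq_iff)
  show "\<forall>f\<in>funs_with_values (insert i L) c.
       (case (f i, f(i := undefined)) of (v, g) \<Rightarrow> g(i := v)) = f" by auto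
  show "(\<lambda>(v, g). g(i := v)) ` (SIGMA v:set_mset c. funs_with_values L (c - {#v#}))
     \<subseteq> funs_with_values (insert i L) c"
    using assms by (auto simp: funs_with_values_def extensional_def upd)
  show "(\<lambda>f. (f i, f(i := undefined))) ` funs_with_values (insert i L) c
     \<subseteq> (SIGMA v:set_mset c. funs_with_values L (c - {#v#}))"
    using assms by (auto simp: funs_with_values_def extensional_def upd)
qed

lemma card_permutations_of_multiset_rec:
  assumes "c \<noteq> {#}"
  shows "card (permutations_of_multiset c) =
    (\<Sum>v\<in>set_mset c. card (permutations_of_multiset (c - {#v#})))"
proof -
  have "card (permutations_of_multiset c) =
      (\<Sum>v\<in>set_mset c. card ((#) v ` permutations_of_multiset (c - {#v#})))"
    unfolding permutations_of_multiset_nonempty[OF assms]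
    by (rule card_UN_disjoint) auto
  then show ?thesis by (simp add: card_image)
qed

text \<open>The value at the inserted label corresponds to the first entry of a permutation, so both
  sides obey the same recursion on \<open>c\<close>.\<close>

lemma card_funs_with_values:
  assumes "finite L" "size c = card L"
  shows "card (funs_with_values L c) = card (permutations_of_multiset c)"
  using assms
proof (induction L arbitrary: c)
  case empty
  then show ?case by (simp add: funs_with_values_empty)
next
  case (insert i L)
  then have c: "c \<noteq> {#}" by auto
  have "card (funs_with_values (insert i L) c) =
      (\<Sum>v\<in>set_mset c. card (funs_with_values L (c - {#v#})))"
    using bij_betw_same_card[OF bij_betw_funs_with_values_insert[OF insert.hyps], of c]
    by (simp add: finite_funs_with_values insert.hyps)
  also have "\<dots> = (\<Sum>v\<in>set_mset c. card (permutations_of_multiset (c - {#v#})))"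
    using insert by (intro sum.cong insert.IH) (auto simp: size_Diff_singleton)
  finally show ?case by (simp add: card_permutations_of_multiset_rec[OF c])
qed

section \<open>Arborescences on blocks of vertices\<close>

text \<open>
  \<open>f i\<close> is the common end of the edges labeled \<open>i\<close>, and \<open>b v\<close> is the label of the edge that starts
  at \<open>v\<close>; thus \<open>b\<close> partitions the vertices other than the root \<open>r\<close> into blocks, one for each label.
\<close>

inductive reaches :: "'v \<Rightarrow> ('v \<Rightarrow> 'l) \<Rightarrow> ('l \<Rightarrow> 'v) \<Rightarrow> 'l \<Rightarrow> bool"
  for r b f where
  base: "f i = r \<Longrightarrow> reaches r b f i"
| step: "reaches r b f (b (f i)) \<Longrightarrow> reaches r b f i"

definition arborescences :: "'v \<Rightarrow> ('v \<Rightarrow> 'l) \<Rightarrow> 'l set \<Rightarrow> 'v multiset \<Rightarrow> ('l \<Rightarrow> 'v) set" where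
  "arborescences r b L c = {f \<in> funs_with_values L c. \<forall>i\<in>L. reaches r b f i}"

text \<open>A path reaches \<open>r\<close> only through a last label with value \<open>r\<close>,
  and it does not leave \<open>L\<close> before that.\<close>

lemma arborescences_empty:
  assumes "finite L" "L \<noteq> {}" "\<And>v. v \<in># c \<Longrightarrow> v = r \<or> b v \<in> L" "r \<notin># c"
  shows "arborescences r b L c = {}"
proof -
  have False if f: "f \<in> funs_with_values L c" and "reaches r b f i" "i \<in> L" for f i
    using that(2,3)
  proof induction
    case (base i)
    then show ?case using funs_with_values_in[OF assms(1) f] assms(4) by auto
  next
    case (step i)
    then show ?case using funs_with_values_in[OF assms(1) f] assms(3,4) by metis
  qed
  then show ?thesis using assms(2) by (auto simp: arborescences_def)
qed

text \<open>The path from \<open>i\<close> under \<open>f\<close> can be followed inside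
  \<open>L\<close>, where \<open>g\<close> agrees with \<open>f\<close>. This allows the value at a
  leaf to be changed.\<close>

lemma reaches_cong:
  assumes "reaches r b f i" "i \<in> L"
    and "\<And>j. j \<in> L \<Longrightarrow> g j = f j"
    and "\<And>j. j \<in> L \<Longrightarrow> f j = r \<or> b (f j) \<in> L"
  shows "reaches r b g i"
  using assms(1,2)
proof induction
  case (base i)
  then show ?case using assms(3) by (auto intro: reaches.base)
next
  case (step i)
  then show ?case using assms(3,4) by (metis reaches.simps)
qed

text \<open>No value other than possibly \<open>r\<close> lies in the block of \<open>i\<close>. So
  \<open>i\<close> is a leaf, and attaching it to any value in \<open>c\<close> does not affect
  which labels in \<open>L\<close> reach \<open>r\<close>.\<close>

lemma card_arborescences_insert:
  assumes "finite L" "i \<notin> L"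
    and c: "\<And>v. v \<in># c \<Longrightarrow> v = r \<or> b v \<in> L"
  shows "card (arborescences r b (insert i L) c) =
    (\<Sum>v\<in>set_mset c. card (arborescences r b L (c - {#v#})))"
proof -
  let ?\<phi> = "\<lambda>(v, g). g(i := v)"
  have iff: "(\<forall>j\<in>insert i L. reaches r b (g(i := v)) j) \<longleftrightarrow> (\<forall>j\<in>L. reaches r b g j)"
    if v: "v \<in># c" and g: "g \<in> funs_with_values L (c - {#v#})" for v g
  proof -
    have gL: "g j = r \<or> b (g j) \<in> L" if "j \<in> L" for j
      using c funs_with_values_in[OF assms(1) g that] by (meson in_diffD)
    have eq: "reaches r b (g(i := v)) j \<longleftrightarrow> reaches r b g j" if "j \<in> L" for j
    proof
      show "reaches r b g j" if "reaches r b (g(i := v)) j"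
        by (rule reaches_cong[OF that \<open>j \<in> L\<close>]) (use gL assms(2) in auto)
      show "reaches r b (g(i := v)) j" if "reaches r b g j"
        by (rule reaches_cong[OF that \<open>j \<in> L\<close>]) (use gL assms(2) in auto)
    qed
    \<comment> \<open>The attached label ends at \<open>r\<close> or enters a block of
      \<open>L\<close>, from which \<open>r\<close> is reached.\<close>
    have "reaches r b (g(i := v)) i" if "\<forall>j\<in>L. reaches r b g j"
      using c[OF v] eq that by (metis fun_upd_same reaches.simps)
    with eq show ?thesis by auto
  qed
  have "bij_betw ?\<phi> (SIGMA v:set_mset c. arborescences r b L (c - {#v#}))
      (arborescences r b (insert i L) c)"
    unfolding bij_betw_def
  proof (intro conjI)
    note bij = bij_betw_funs_with_values_insert[OF assms(1,2), of c]
    show "inj_on ?\<phi> (SIGMA v:set_mset c. arborescences r b L (c - {#v#}))"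
      by (rule inj_on_subset[OF bij_betw_imp_inj_on[OF bij]]) (auto simp: arborescences_def)
    show "?\<phi> ` (SIGMA v:set_mset c. arborescences r b L (c - {#v#})) =
        arborescences r b (insert i L) c"
    proof (intro equalityI subsetI)
      fix f assume "f \<in> ?\<phi> ` (SIGMA v:set_mset c. arborescences r b L (c - {#v#}))"
      then obtain v g where f: "f = g(i := v)" "v \<in># c"
          "g \<in> funs_with_values L (c - {#v#})" "\<forall>j\<in>L. reaches r b g j"
        by (auto simp: arborescences_def)
      moreover have "f \<in> funs_with_values (insert i L) c"
        using f bij_betwE[OF bij] by auto
      ultimately show "f \<in> arborescences r b (insert i L) c"
        unfolding arborescences_def using iff by blast
    next
      fix f assume f: "f \<in> arborescences r b (insert i L) c"
      then have "f \<in> ?\<phi> ` (SIGMA v:set_mset c. funs_with_values L (c - {#v#}))"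
        using bij_betw_imp_surj_on[OF bij] by (auto simp: arborescences_def)
      then obtain v g where g: "f = g(i := v)" "v \<in># c" "g \<in> funs_with_values L (c - {#v#})"
        by auto
      moreover have "\<forall>j\<in>L. reaches r b g j"
        using iff[OF g(2,3)] f g(1) unfolding arborescences_def by blast
      ultimately show "f \<in> ?\<phi> ` (SIGMA v:set_mset c. arborescences r b L (c - {#v#}))"
        by (force simp: arborescences_def)
    qed
  qed
  then have "card (arborescences r b (insert i L) c) =
      card (SIGMA v:set_mset c. arborescences r b L (c - {#v#}))"
    by (simp add: bij_betw_same_card)
  also have "\<dots> = (\<Sum>v\<in>set_mset c. card (arborescences r b L (c - {#v#})))"
    by (rule card_SigmaI)
      (auto simp: arborescences_def intro!: finite_subset[OF _ finite_funs_with_values[OF assms(1)]])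
  finally show ?thesis .
qed

text \<open>
  A label whose block is disjoint from \<open>c\<close> is a leaf of every arborescence with value multiset
  \<open>c\<close>, so it can be removed. It is the choice of the leaf by \<open>c\<close> alone that makes the numbers of
  arborescences satisfy the recursion of the permutations of \<open>c\<close> with a fixed last entry \<open>r\<close>.
\<close>

lemma card_arborescences:
  assumes "finite L" "L \<noteq> {}" "size c = card L" "b r \<notin> L"
    and "\<And>v. v \<in># c \<Longrightarrow> v = r \<or> b v \<in> L"
  shows "card (arborescences r b L c) =
    (if r \<in># c then card (permutations_of_multiset (c - {#r#})) else 0)"
  using assms
proof (induction "card L" arbitrary: L c)
  case 0
  then show ?case by simp
next
  case (Suc N)
  note c = Suc.prems(5)
  show ?case
  proof (cases "r \<in># c")
    case False
    then show ?thesis using arborescences_empty[OF Suc.prems(1,2) c] by auto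
  next
    case True
    \<comment> \<open>Pigeonhole: without one \<open>r\<close>, fewer than \<open>card L\<close>
      values remain, so some block contains none of them. The removed \<open>r\<close> lies in no
      block indexed by \<open>L\<close>.\<close>
    have "card (b ` set_mset (c - {#r#})) \<le> size (c - {#r#})"
      by (metis mset_set_set_mset_msubset set_image_mset size_image_mset size_mset_mono
          size_mset_set)
    also have "\<dots> < card L" using Suc True by (simp add: size_Diff_singleton)
    finally have "\<not> L \<subseteq> b ` set_mset (c - {#r#})"
      by (meson card_mono finite_imageI finite_set_mset leD)
    then obtain i where i: "i \<in> L" "i \<notin> b ` set_mset (c - {#r#})" by auto
    define L' where "L' = L - {i}"
    have L: "L = insert i L'" "i \<notin> L'" "finite L'" "card L' = N"
      using i Suc by (auto simp: L'_def)
    have bv: "v = r \<or> b v \<in> L'" if "v \<in># c" for v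
      using c[OF that] that i(2) by (auto simp: L'_def in_diff_count)
    have "card (arborescences r b L c) =
        (\<Sum>v\<in>set_mset c. card (arborescences r b L' (c - {#v#})))"
      unfolding L(1) using L(2,3) bv by (intro card_arborescences_insert) auto
    also have "\<dots> = card (permutations_of_multiset (c - {#r#}))"
    \<comment> \<open>The formula fails for an empty label set, where the empty map counts but
      \<open>r\<close> does not occur. Hence a single label is treated separately.\<close>
    proof (cases "L' = {}")
      case True
      then have "size c = 1" using Suc.prems(3) L by simp
      then obtain x where "c = {#x#}" using size_1_singleton_mset by blast
      then have "c = {#r#}" using \<open>r \<in># c\<close> by auto
      then show ?thesis
        using True by (simp add: arborescences_def funs_with_values_empty)
    next
      case False
      have "(\<Sum>v\<in>set_mset c. card (arborescences r b L' (c - {#v#}))) =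
          (\<Sum>v\<in>set_mset c. if r \<in># c - {#v#}
             then card (permutations_of_multiset (c - {#v#} - {#r#})) else 0)"
      proof (rule sum.cong)
        fix v assume v: "v \<in> set_mset c"
        show "card (arborescences r b L' (c - {#v#})) = (if r \<in># c - {#v#}
             then card (permutations_of_multiset (c - {#v#} - {#r#})) else 0)"
        proof (rule Suc.hyps(1))
          show "size (c - {#v#}) = card L'" using v Suc.prems(3) L
            by (simp add: size_Diff_singleton)
          show "u = r \<or> b u \<in> L'" if "u \<in># c - {#v#}" for u
            using bv that by (meson in_diffD)
        qed (use False L Suc.prems in auto)
      qed simp
      also have "\<dots> = (\<Sum>v\<in>{v \<in> set_mset c. r \<in># c - {#v#}}.
          card (permutations_of_multiset (c - {#v#} - {#r#})))"
        by (rule sum.inter_filter[symmetric]) simp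
      \<comment> \<open>Removing \<open>v\<close> leaves an \<open>r\<close> unless \<open>v\<close>
        is the only copy of \<open>r\<close>.\<close>
      also have "{v \<in> set_mset c. r \<in># c - {#v#}} = set_mset (c - {#r#})"
        using True by (auto simp: in_diff_count split: if_splits)
      also have "(\<Sum>v\<in>set_mset (c - {#r#}). card (permutations_of_multiset (c - {#v#} - {#r#}))) =
          card (permutations_of_multiset (c - {#r#}))"
      proof -
        have "size (c - {#r#}) \<noteq> 0"
          using False L Suc.prems(3) True by (auto simp: size_Diff_singleton)
        then have "c - {#r#} \<noteq> {#}" by auto
        \<comment> \<open>Removing \<open>v\<close> and removing \<open>r\<close> commute, so the
          sum is the recursion for \<open>c - {#r#}\<close>.\<close>
        from card_permutations_of_multiset_rec[OF this] show ?thesis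
          by (simp add: add_mset_commute)
      qed
      finally show ?thesis .
    qed
    finally show ?thesis using True by simp
  qed
qed

text \<open>The blocks \<open>b r\<close> may vary with the root because the number of arborescences
  does not depend on them. Summing over the fixed entry \<open>r\<close> runs through all
  permutations of \<open>c\<close>.\<close>

lemma sum_card_arborescences:
  assumes "finite L" "finite R" "size c = card L" "set_mset c \<subseteq> R" "L \<noteq> {}"
    and "\<And>r. r \<in> R \<Longrightarrow> b r r \<notin> L"
    and "\<And>r v. r \<in> R \<Longrightarrow> v \<in># c \<Longrightarrow> v = r \<or> b r v \<in> L"
  shows "(\<Sum>r\<in>R. card (arborescences r (b r) L c)) = card (funs_with_values L c)"
proof -
  have "(\<Sum>r\<in>R. card (arborescences r (b r) L c)) =
      (\<Sum>r\<in>R. if r \<in># c then card (permutations_of_multiset (c - {#r#})) else 0)"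
    using assms by (intro sum.cong card_arborescences) auto
  also have "\<dots> = (\<Sum>r\<in>set_mset c. card (permutations_of_multiset (c - {#r#})))"
    using assms(2,4) by (intro sum.mono_neutral_cong_right) auto
  also have "\<dots> = card (permutations_of_multiset c)"
    using assms by (intro card_permutations_of_multiset_rec[symmetric]) auto
  finally show ?thesis using assms by (simp add: card_funs_with_values)
qed

subsection \<open>Labeled graphs as parent maps\<close>

text \<open>Along \<open>X\<close>, both maps list the same multiset in sorted order. This is how
  the order condition comes to determine the labels.\<close>

lemma mono_on_eq_if_image_mset_eq:
  fixes b b' :: "'a::linorder \<Rightarrow> 'b::linorder"
  assumes "finite X" "mono_on X b" "mono_on X b'"
    and eq: "image_mset b (mset_set X) = image_mset b' (mset_set X)" and "v \<in> X"
  shows "b v = b' v"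
proof -
  let ?xs = "sorted_list_of_set X"
  have sorted: "sorted (map g ?xs)" if "mono_on X g" for g :: "'a \<Rightarrow> 'b"
    unfolding sorted_wrt_map
    by (rule sorted_wrt_mono_rel[OF _ sorted_sorted_list_of_set])
      (use that assms(1) in \<open>auto simp: mono_on_def\<close>)
  have "mset ?xs = mset_set X"
    by (metis mset_sorted_list_of_multiset sorted_list_of_mset_set)
  then have "mset (map b ?xs) = mset (map b' ?xs)"
    using eq by simp
  from properties_for_sort[OF this sorted[OF assms(2)]]
  have "map b ?xs = map b' ?xs"
    using properties_for_sort[OF refl sorted[OF assms(3)]] by simp
  then show ?thesis using assms(1,5) by simp
qed

lemma size_sum_replicate_mset: "size (\<Sum>i\<in>A. replicate_mset (g i) i) = sum g A"
  by (induction A rule: infinite_finite_induct) auto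

lemma in_sum_replicate_mset:
  "finite A \<Longrightarrow> x \<in># (\<Sum>i\<in>A. replicate_mset (g i) i) \<longleftrightarrow> x \<in> A \<and> g x > 0"
  by (induction A rule: finite_induct) auto

section \<open>Edge labels determined by the root\<close>

locale label_multiplicities =
  fixes n :: nat and m :: "nat \<Rightarrow> nat"
  assumes m_pos: "i \<in> {1..n} \<Longrightarrow> m i \<ge> 1"
begin

definition N :: nat where "N = total_mult n m - n"

definition singles :: "nat set" where "singles = {i \<in> {1..n}. m i = 1}"

definition vertices :: "vlabel set" where "vertices = Num ` {0..N} \<union> Sym ` singles"

text \<open>A label of multiplicity one contributes no copy, since its only edge starts at its
  symbol. The copies listed here belong to the edges starting at integer vertices.\<close>

definition num_labels :: "nat multiset" where
  "num_labels = (\<Sum>i\<in>{1..n}. replicate_mset (m i - 1) i)"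

lemma finite_singles [simp]: "finite singles"
  by (simp add: singles_def)

lemma finite_vertices [simp]: "finite vertices"
  by (simp add: vertices_def)

lemma size_num_labels [simp]: "size num_labels = N"
proof -
  \<comment> \<open>Subtraction is truncated, but by \<open>m_pos\<close> each
    \<open>m i - 1\<close> is a genuine difference.\<close>
  have "(\<Sum>i\<in>{1..n}. m i - 1) = (\<Sum>i\<in>{1..n}. m i) - (\<Sum>i\<in>{1..n}. 1)"
    by (rule sum_subtractf_nat) (rule m_pos)
  then show ?thesis
    by (simp add: num_labels_def size_sum_replicate_mset N_def total_mult_def)
qed

lemma set_num_labels: "set_mset num_labels = {1..n} - singles"
proof (rule set_eqI)
  fix i
  show "i \<in># num_labels \<longleftrightarrow> i \<in> {1..n} - singles"
    unfolding num_labels_def in_sum_replicate_mset[OF finite_atLeastAtMost] singles_def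
    using m_pos[of i] by auto
qed

lemma all_labels_eq:
  "(\<Sum>i\<in>{1..n}. replicate_mset (if m i > 1 then m i - 1 else 1) i) = num_labels + mset_set singles"
proof -
  have "(\<Sum>i\<in>{1..n}. replicate_mset (if m i > 1 then m i - 1 else 1) i) =
      (\<Sum>i\<in>{1..n}. replicate_mset (m i - 1) i + (if m i = 1 then {#i#} else {#}))"
  proof (rule sum.cong)
    fix i assume "i \<in> {1..n}"
    from m_pos[OF this] show "replicate_mset (if m i > 1 then m i - 1 else 1) i =
        replicate_mset (m i - 1) i + (if m i = 1 then {#i#} else {#})"
      by (cases "m i = 1") auto
  qed simp
  also have "\<dots> = num_labels + (\<Sum>i\<in>singles. {#i#})"
    unfolding num_labels_def singles_def
    by (simp only: sum.distrib sum.inter_filter finite_atLeastAtMost)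
  finally show ?thesis by simp
qed

text \<open>
  By the order condition, reading the labels of the edges that start at integer vertices along
  these vertices lists \<open>num_labels\<close> in increasing order; the root \<open>r\<close> is skipped. The value \<open>0\<close>
  at \<open>r\<close> is not a label.
\<close>

definition block_label :: "nat \<Rightarrow> nat \<Rightarrow> nat" where
  "block_label r v = (if v \<le> N \<and> v \<noteq> r
     then sorted_list_of_multiset num_labels ! (if v < r then v else v - 1) else 0)"

lemma length_sorted_num_labels [simp]: "length (sorted_list_of_multiset num_labels) = N"
  by (metis mset_sorted_list_of_multiset size_mset size_num_labels)

lemma mono_on_block_label:
  assumes "r \<le> N"
  shows "mono_on ({0..N} - {r}) (block_label r)"
proof (rule mono_onI)
  fix v w assume "v \<in> {0..N} - {r}" "w \<in> {0..N} - {r}" "v \<le> w"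
  then show "block_label r v \<le> block_label r w"
    using assms by (auto simp: block_label_def intro!: sorted_nth_mono)
qed

lemma image_mset_block_label:
  assumes "r \<le> N"
  shows "image_mset (block_label r) (mset_set ({0..N} - {r})) = num_labels"
proof -
  let ?X = "{0..N} - {r}"
  let ?ls = "sorted_list_of_multiset num_labels"
  \<comment> \<open>Closing the gap at \<open>r\<close> makes the remaining vertices correspond to
    the list positions below \<open>N\<close>.\<close>
  let ?pos = "\<lambda>v. if v < r then v else v - 1"
  have inj: "inj_on ?pos ?X" by (auto simp: inj_on_def split: if_splits)
  have "?pos ` ?X = {..<N}"
  proof (intro equalityI subsetI)
    fix k assume "k \<in> {..<N}"
    then have "k = ?pos (if k < r then k else Suc k)" "(if k < r then k else Suc k) \<in> ?X"
      using assms by auto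
    then show "k \<in> ?pos ` ?X" by blast
  qed (use assms in \<open>auto split: if_splits\<close>)
  then have "image_mset ?pos (mset_set ?X) = mset [0..<N]"
    using image_mset_mset_set[OF inj] by (simp add: mset_set_upto_eq_mset_upto)
  then have "image_mset (\<lambda>v. ?ls ! ?pos v) (mset_set ?X) = image_mset ((!) ?ls) (mset [0..<N])"
    by (metis (no_types, lifting) multiset.map_comp comp_def image_mset_cong)
  also have "\<dots> = mset (map ((!) ?ls) [0..<length ?ls])" by simp
  also have "\<dots> = num_labels" unfolding map_nth by simp
  also have "image_mset (\<lambda>v. ?ls ! ?pos v) (mset_set ?X) = image_mset (block_label r) (mset_set ?X)"
    by (intro image_mset_cong) (auto simp: block_label_def)
  finally show ?thesis .
qed

lemma block_label_self [simp]: "block_label r r = 0"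
  by (simp add: block_label_def)

lemma block_label_image:
  assumes "r \<le> N"
  shows "block_label r ` ({0..N} - {r}) = {1..n} - singles"
  using arg_cong[OF image_mset_block_label[OF assms], of set_mset]
  by (simp add: set_num_labels)

text \<open>The symbol condition forces the label \<open>i\<close> on the edge leaving
  \<open>Sym i\<close>.\<close>

definition out_label :: "nat \<Rightarrow> vlabel \<Rightarrow> nat" where
  "out_label r u = (case u of Num v \<Rightarrow> block_label r v | Sym i \<Rightarrow> i)"

lemma out_label_simps [simp]:
  "out_label r (Num v) = block_label r v" "out_label r (Sym i) = i"
  by (simp_all add: out_label_def)

lemma vertices_Diff_root: "vertices - {Num r} = Num ` ({0..N} - {r}) \<union> Sym ` singles"
  by (auto simp: vertices_def)

lemma out_label_image:
  assumes "r \<le> N"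
  shows "out_label r ` (vertices - {Num r}) = {1..n}"
proof -
  have "out_label r ` (vertices - {Num r}) = block_label r ` ({0..N} - {r}) \<union> singles"
    by (simp add: vertices_Diff_root image_Un image_image)
  also have "\<dots> = {1..n}"
    using block_label_image[OF assms] by (auto simp: singles_def)
  finally show ?thesis .
qed

lemma image_mset_vertices_Diff_root:
  "image_mset g (mset_set (vertices - {Num r})) =
    image_mset (\<lambda>v. g (Num v)) (mset_set ({0..N} - {r})) +
    image_mset (\<lambda>i. g (Sym i)) (mset_set singles)"
proof -
  have "mset_set (vertices - {Num r}) =
      mset_set (Num ` ({0..N} - {r})) + mset_set (Sym ` singles)"
    unfolding vertices_Diff_root by (rule mset_set_Union) auto
  also have "\<dots> = image_mset Num (mset_set ({0..N} - {r})) + image_mset Sym (mset_set singles)"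
    by (simp add: image_mset_mset_set inj_on_def)
  finally show ?thesis by (simp add: multiset.map_comp comp_def)
qed

lemma out_labelE:
  assumes "r \<le> N" "i \<in> {1..n}"
  obtains u where "u \<in> vertices - {Num r}" "i = out_label r u"
  using assms(2) unfolding out_label_image[OF assms(1), symmetric] by (rule imageE)

section \<open>The graph of a root and a map on labels\<close>

definition label_graph :: "nat \<Rightarrow> (nat \<Rightarrow> nat) \<Rightarrow> lgraph" where
  "label_graph r f = \<lparr>verts = vertices,
     arcs = (\<lambda>u. (u, out_label r u, Num (f (out_label r u)))) ` (vertices - {Num r}),
     tail = edge_start, head = edge_end\<rparr>"

lemma label_graph_simps [simp]:
  "verts (label_graph r f) = vertices"
  "tail (label_graph r f) = edge_start"
  "head (label_graph r f) = edge_end"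
  by (simp_all add: label_graph_def)

lemma arcs_label_graph:
  "arcs (label_graph r f) =
    (\<lambda>u. (u, out_label r u, Num (f (out_label r u)))) ` (vertices - {Num r})"
  by (simp add: label_graph_def)

lemma out_arcs_label_graph:
  assumes "u \<in> vertices" "u \<noteq> Num r"
  shows "out_arcs (label_graph r f) u = {(u, out_label r u, Num (f (out_label r u)))}"
  using assms by (auto simp: out_arcs_def arcs_label_graph)

lemma out_arcs_label_graph_root: "out_arcs (label_graph r f) (Num r) = {}"
  by (auto simp: out_arcs_def arcs_label_graph)

text \<open>The conditions of \<open>UG\<close> with an arbitrary integer root, so that graphs and
  trees share one classification.\<close>

definition rooted_at :: "nat \<Rightarrow> lgraph \<Rightarrow> bool" where
  "rooted_at r G \<longleftrightarrow> labeled_digraph G \<and> labeling_conds n m G \<and>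
     out_degree G (Num r) = 0 \<and>
     (\<forall>v\<in>verts G. v \<noteq> Num r \<longrightarrow> out_degree G v = 1)"

lemma vertex_label_cond_iff: "vertex_label_cond n m G \<longleftrightarrow> verts G = vertices"
  by (simp add: vertex_label_cond_def vertices_def singles_def N_def)

lemma Num_in_vertices [simp]: "Num v \<in> vertices \<longleftrightarrow> v \<le> N"
  by (auto simp: vertices_def)

lemma Sym_in_vertices [simp]: "Sym i \<in> vertices \<longleftrightarrow> i \<in> singles"
  by (auto simp: vertices_def)

lemma fin_digraph_label_graph:
  assumes "r \<le> N" "f \<in> {1..n} \<rightarrow> {0..N}"
  shows "fin_digraph (label_graph r f)"
proof
  fix e assume "e \<in> arcs (label_graph r f)"
  then obtain u where u: "u \<in> vertices - {Num r}" "e = (u, out_label r u, Num (f (out_label r u)))"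
    by (auto simp: arcs_label_graph)
  moreover have "out_label r u \<in> {1..n}" using out_label_image[OF assms(1)] u(1) by blast
  ultimately show "tail (label_graph r f) e \<in> verts (label_graph r f)"
    "head (label_graph r f) e \<in> verts (label_graph r f)"
    using assms(2) by auto
qed (simp_all add: arcs_label_graph)

lemma rooted_at_label_graph:
  assumes r: "r \<le> N" and f: "f \<in> {1..n} \<rightarrow> {0..N}"
  shows "rooted_at r (label_graph r f)"
proof -
  let ?G = "label_graph r f"
  have "labeled_digraph ?G"
    using fin_digraph_label_graph[OF assms] by (simp add: labeled_digraph_def)
  moreover have "out_degree ?G (Num r) = 0"
    by (simp add: out_degree_def out_arcs_label_graph_root)
  moreover have "\<forall>v\<in>verts ?G. v \<noteq> Num r \<longrightarrow> out_degree ?G v = 1"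
    by (simp add: out_degree_def out_arcs_label_graph)
  moreover have "vertex_label_cond n m ?G"
    by (simp add: vertex_label_cond_iff)
  moreover have "symbol_cond n m ?G"
    unfolding symbol_cond_def
  proof (intro ballI impI)
    fix i v assume i: "i \<in> {1..n}" "m i = 1" and v: "v \<in> verts ?G"
    then have iS: "i \<in> singles" by (simp add: singles_def)
    show "v = Sym i \<longleftrightarrow> leaf ?G v \<and> (\<exists>e\<in>out_arcs ?G v. edge_label e = i)"
    proof
      assume "v = Sym i"
      then show "leaf ?G v \<and> (\<exists>e\<in>out_arcs ?G v. edge_label e = i)"
        using v by (simp add: leaf_def out_arcs_label_graph) (auto simp: in_arcs_def arcs_label_graph)
    next
      assume *: "leaf ?G v \<and> (\<exists>e\<in>out_arcs ?G v. edge_label e = i)"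
      then have "v \<noteq> Num r" using out_arcs_label_graph_root by fastforce
      then have "out_label r v = i" using * v by (auto simp: out_arcs_label_graph)
      then show "v = Sym i"
      proof (cases v)
        case (Num w)
        \<comment> \<open>Edges leaving integer vertices carry only labels of multiplicity above
          one.\<close>
        then have "i \<in> {1..n} - singles"
          using \<open>v \<noteq> Num r\<close> \<open>out_label r v = i\<close> v block_label_image[OF r] by auto
        then show ?thesis using iS by simp
      qed auto
    qed
  qed
  moreover have "edge_label_cond n m ?G"
  proof -
    have "image_mset edge_label (mset_set (arcs ?G)) =
        image_mset (out_label r) (mset_set (vertices - {Num r}))"
      unfolding arcs_label_graph
      by (subst image_mset_mset_set[symmetric]) (auto simp: inj_on_def multiset.map_comp comp_def)
    also have "\<dots> = num_labels + mset_set singles"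
      by (simp add: image_mset_vertices_Diff_root image_mset_block_label[OF r])
    finally show ?thesis
      unfolding edge_label_cond_def all_labels_eq by (auto simp: arcs_label_graph)
  qed
  moreover have "order_cond ?G"
    unfolding order_cond_def
  proof (intro ballI allI impI)
    fix e e' v v'
    assume e: "e \<in> arcs ?G" "e' \<in> arcs ?G"
      and ne: "edge_label e \<noteq> edge_label e' \<and> tail ?G e = Num v \<and> tail ?G e' = Num v'"
    then have "v \<in> {0..N} - {r}" "v' \<in> {0..N} - {r}"
        "edge_label e = block_label r v" "edge_label e' = block_label r v'"
      by (auto simp: arcs_label_graph)
    \<comment> \<open>Weak monotonicity in both directions suffices because the two labels
      differ.\<close>
    moreover from this have "v \<le> v' \<Longrightarrow> edge_label e \<le> edge_label e'"
        "v' \<le> v \<Longrightarrow> edge_label e' \<le> edge_label e"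
      using mono_onD[OF mono_on_block_label[OF r]] by auto
    ultimately show "edge_label e < edge_label e' \<longleftrightarrow> v < v'"
      using ne by linarith
  qed
  ultimately show ?thesis by (simp add: rooted_at_def labeling_conds_def)
qed

text \<open>The symbol and order conditions fix every edge label; the only remaining freedom is one
  integer end for each label.\<close>

lemma label_graph_if_rooted_at:
  assumes G: "rooted_at r G" and r: "r \<le> N"
  obtains f where "f \<in> {1..n} \<rightarrow>\<^sub>E {0..N}" "G = label_graph r f"
proof -
  have conds: "symbol_cond n m G" "edge_label_cond n m G" "order_cond G"
    and th [simp]: "tail G = edge_start" "head G = edge_end" and V [simp]: "verts G = vertices"
    and "fin_digraph G"
    using G by (auto simp: rooted_at_def labeling_conds_def labeled_digraph_def vertex_label_cond_iff)
  interpret fin_digraph G by fact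
  have out_root: "out_arcs G (Num r) = {}"
    using G by (simp add: rooted_at_def out_degree_def finite_out_arcs)
  have "\<exists>e. out_arcs G u = {e}" if "u \<in> vertices - {Num r}" for u
    using G that by (auto simp: rooted_at_def out_degree_def card_1_singleton_iff)
  then obtain a where a: "\<And>u. u \<in> vertices - {Num r} \<Longrightarrow> out_arcs G u = {a u}" by metis
  have start: "edge_start (a u) = u" "a u \<in> arcs G" if "u \<in> vertices - {Num r}" for u
    using a[OF that] by (auto simp: out_arcs_def)
  have arcs: "arcs G = a ` (vertices - {Num r})"
  proof (intro equalityI subsetI)
    fix e assume e: "e \<in> arcs G"
    have "edge_start e \<noteq> Num r"
      using out_root e by (metis empty_iff in_out_arcs_conv th(1))
    then have "edge_start e \<in> vertices - {Num r}"
      using tail_in_verts[OF e] by simp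
    moreover from this have "e = a (edge_start e)"
      using a e by (force simp: out_arcs_def)
    ultimately show "e \<in> a ` (vertices - {Num r})" by blast
  qed (use start(2) in blast)
  define lab where "lab u = edge_label (a u)" for u
  have Sym_leaf: "leaf G (Sym i)" "lab (Sym i) = i" if "i \<in> singles" for i
  proof -
    have "i \<in> {1..n}" "m i = 1" using that by (auto simp: singles_def)
    then have "leaf G (Sym i) \<and> (\<exists>e\<in>out_arcs G (Sym i). edge_label e = i)"
      using conds(1) that unfolding symbol_cond_def V by (metis Sym_in_vertices)
    then show "leaf G (Sym i)" "lab (Sym i) = i"
      using a[of "Sym i"] that by (auto simp: lab_def)
  qed
  have inj: "inj_on a (vertices - {Num r})"
    using start by (metis inj_onI)
  have "image_mset edge_label (mset_set (arcs G)) = image_mset lab (mset_set (vertices - {Num r}))"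
    unfolding arcs by (subst image_mset_mset_set[OF inj, symmetric])
      (simp add: multiset.map_comp comp_def lab_def[abs_def])
  then have labs: "image_mset lab (mset_set (vertices - {Num r})) = num_labels + mset_set singles"
    using conds(2) unfolding edge_label_cond_def all_labels_eq by simp
  \<comment> \<open>The symbols use up exactly \<open>mset_set singles\<close>; cancelling leaves
    \<open>num_labels\<close> for the integer vertices.\<close>
  have "image_mset (\<lambda>i. lab (Sym i)) (mset_set singles) = image_mset (\<lambda>i. i) (mset_set singles)"
    using Sym_leaf(2) by (intro image_mset_cong) auto
  then have "image_mset (\<lambda>v. lab (Num v)) (mset_set ({0..N} - {r})) = num_labels"
    using labs by (simp add: image_mset_vertices_Diff_root)
  moreover have "mono_on ({0..N} - {r}) (\<lambda>v. lab (Num v))"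
  proof (rule mono_onI)
    fix v w assume *: "v \<in> {0..N} - {r}" "w \<in> {0..N} - {r}" "v \<le> w"
    then have "a (Num v) \<in> arcs G" "tail G (a (Num v)) = Num v"
        "a (Num w) \<in> arcs G" "tail G (a (Num w)) = Num w"
      using start[of "Num v"] start[of "Num w"] by auto
    then have "lab (Num w) \<noteq> lab (Num v) \<Longrightarrow> lab (Num w) < lab (Num v) \<longleftrightarrow> w < v"
      using conds(3) unfolding order_cond_def lab_def by blast
    then show "lab (Num v) \<le> lab (Num w)"
      using *(3) by (metis leD le_cases nat_less_le)
  qed
  ultimately have "lab (Num v) = block_label r v" if "v \<in> {0..N} - {r}" for v
    using that mono_on_eq_if_image_mset_eq[OF _ _ mono_on_block_label[OF r], of "\<lambda>v. lab (Num v)" v]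
      image_mset_block_label[OF r] by simp
  then have lab: "lab u = out_label r u" if "u \<in> vertices - {Num r}" for u
    using that Sym_leaf(2) by (cases u) auto
  \<comment> \<open>Symbols are leaves, so every edge ends at an integer vertex; edges labeled
    \<open>i\<close> are siblings and share this end.\<close>
  have "\<exists>j\<in>{0..N}. \<forall>e\<in>arcs G. edge_label e = i \<longrightarrow> edge_end e = Num j" if i: "i \<in> {1..n}" for i
  proof -
    obtain u where u: "u \<in> vertices - {Num r}" "i = lab u"
      using out_labelE[OF r i] lab by metis
    have "edge_end (a u) \<in> vertices" using head_in_verts[OF start(2)[OF u(1)]] by simp
    moreover have "edge_end (a u) \<noteq> Sym i" if "i \<in> singles" for i
      using Sym_leaf(1)[OF that] start(2)[OF u(1)]
      by (metis empty_iff in_in_arcs_conv leaf_def th(2))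
    ultimately obtain j where "j \<le> N" "edge_end (a u) = Num j"
      by (cases "edge_end (a u)") auto
    moreover have "edge_end e = edge_end (a u)" if "e \<in> arcs G" "edge_label e = i" for e
      using conds(2) that start(2)[OF u(1)] u(2) unfolding edge_label_cond_def lab_def th by blast
    ultimately show ?thesis by (metis atLeastAtMost_iff le0)
  qed
  then obtain g where g: "\<And>i. i \<in> {1..n} \<Longrightarrow> g i \<in> {0..N}"
      "\<And>i e. i \<in> {1..n} \<Longrightarrow> e \<in> arcs G \<Longrightarrow> edge_label e = i \<Longrightarrow> edge_end e = Num (g i)"
    by metis
  define f where "f = restrict g {1..n}"
  have "a u = (u, out_label r u, Num (f (out_label r u)))" if u: "u \<in> vertices - {Num r}" for u
  proof -
    have "out_label r u \<in> {1..n}" using u out_label_image[OF r] by blast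
    moreover from this have "edge_end (a u) = Num (g (out_label r u))"
      using g(2) start(2)[OF u] lab[OF u] by (simp add: lab_def)
    ultimately show ?thesis
      using start(1)[OF u] lab[OF u] by (cases "a u") (simp add: lab_def f_def)
  qed
  then have "arcs G = arcs (label_graph r f)"
    unfolding arcs arcs_label_graph by (rule image_cong[OF refl])
  then have "G = label_graph r f" by (simp add: pre_digraph.equality)
  moreover have "f \<in> {1..n} \<rightarrow>\<^sub>E {0..N}" using g(1) by (simp add: f_def)
  ultimately show ?thesis using that by blast
qed

text \<open>The root is the only vertex from which no edge starts. Each label occurs on some edge,
  whose end exhibits the value of \<open>f\<close>.\<close>

lemma label_graph_inject:
  assumes "r \<le> N" "r' \<le> N" "f \<in> extensional {1..n}" "f' \<in> extensional {1..n}"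
    and eq: "label_graph r f = label_graph r' f'"
  shows "r = r' \<and> f = f'"
proof -
  have "edge_start ` arcs (label_graph r f) = vertices - {Num r}" for r f
    by (simp add: arcs_label_graph image_image)
  then have "vertices - {Num r} = vertices - {Num r'}" using eq by metis
  moreover have "Num r \<in> vertices" "Num r' \<in> vertices" using assms by auto
  ultimately have r: "r = r'" by blast
  have "f i = f' i" if "i \<in> {1..n}" for i
  proof -
    obtain u where u: "u \<in> vertices - {Num r}" "i = out_label r u"
      using out_labelE[OF assms(1) \<open>i \<in> {1..n}\<close>] .
    then have "(u, i, Num (f i)) \<in> arcs (label_graph r' f')"
      using eq[symmetric] by (auto simp: arcs_label_graph)
    then show ?thesis using r u by (auto simp: arcs_label_graph)
  qed
  then have "f = f'" by (rule extensionalityI[OF assms(3,4)])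
  with r show ?thesis ..
qed

text \<open>Every label occurs and all its edges share the end given by \<open>f\<close>, so the
  distinct incoming labels form a fibre.\<close>

lemma num_in_labels_label_graph:
  assumes "r \<le> N"
  shows "num_in_labels (label_graph r f) (Num j) = card {i \<in> {1..n}. f i = j}"
proof -
  have "edge_label ` in_arcs (label_graph r f) (Num j) =
      {i \<in> out_label r ` (vertices - {Num r}). f i = j}"
    by (auto simp: in_arcs_def arcs_label_graph image_iff)
  then show ?thesis by (simp add: num_in_labels_def out_label_image[OF assms])
qed

text \<open>With at most one edge leaving each vertex and none leaving the root, walks to the root
  are unique. Their existence is what \<open>reaches\<close> expresses, on labels instead of
  vertices.\<close>

lemma rooted_in_tree_label_graph_iff:
  assumes r: "r \<le> N" and f: "f \<in> {1..n} \<rightarrow> {0..N}"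
  shows "rooted_in_tree (label_graph r f) (Num r) \<longleftrightarrow>
    (\<forall>i\<in>{1..n}. reaches r (block_label r) f i)" (is "_ \<longleftrightarrow> ?R")
proof -
  let ?G = "label_graph r f"
  let ?e = "\<lambda>u. (u, out_label r u, Num (f (out_label r u)))"
  interpret fin_digraph ?G by (rule fin_digraph_label_graph[OF assms])
  have Cons_iff: "awalk u (e # p) v \<longleftrightarrow>
      u \<in> vertices - {Num r} \<and> e = ?e u \<and> awalk (Num (f (out_label r u))) p v" for u e p v
  proof -
    have "e \<in> arcs ?G \<and> u = edge_start e \<longleftrightarrow> u \<in> vertices - {Num r} \<and> e = ?e u"
      by (cases e) (auto simp: arcs_label_graph)
    then show ?thesis
      unfolding awalk_Cons_iff label_graph_simps by (metis edge_end.simps)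
  qed
  have Nil_iff: "awalk u [] v \<longleftrightarrow> u = v \<and> u \<in> vertices" for u v
    by (simp add: awalk_Nil_iff)
  have unique: "p = q" if "awalk u p (Num r)" "awalk u q (Num r)" for u p q
    using that
  proof (induction p arbitrary: u q)
    case Nil
    then show ?case by (cases q) (auto simp: Nil_iff Cons_iff)
  next
    case (Cons e p)
    then obtain e' q' where q: "q = e' # q'"
      by (cases q) (auto simp: Nil_iff Cons_iff)
    show ?case using Cons unfolding q Cons_iff by blast
  qed
  have walk: "\<exists>p. awalk u p (Num r)"
    if "reaches r (block_label r) f i" "u \<in> vertices - {Num r}" "out_label r u = i" for u i
    using that
  proof (induction arbitrary: u)
    case (base i)
    then have "awalk u [?e u] (Num r)"
      using r by (simp add: Cons_iff Nil_iff)
    then show ?case by blast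
  next
    case (step i)
    have "out_label r u \<in> {1..n}" using step.prems(1) out_label_image[OF r] by blast
    then have fi: "f i \<in> {0..N}" using f step.prems by blast
    have "\<exists>p. awalk (Num (f i)) p (Num r)"
    \<comment> \<open>The rule \<open>step\<close> does not exclude \<open>f i = r\<close>; the
      empty walk serves there.\<close>
    proof (cases "f i = r")
      case True
      then show ?thesis using r by (metis Nil_iff Num_in_vertices)
    qed (use step.IH fi in auto)
    then obtain p where "awalk (Num (f i)) p (Num r)" ..
    then have "awalk u (?e u # p) (Num r)"
      using step.prems by (simp add: Cons_iff)
    then show ?case by blast
  qed
  have reach: "reaches r (block_label r) f (out_label r u)"
    if "awalk u p (Num r)" "u \<noteq> Num r" for u p
    using that
  proof (induction p arbitrary: u)
    case Nil
    then show ?case by (simp add: Nil_iff)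
  next
    case (Cons e p)
    then have "awalk (Num (f (out_label r u))) p (Num r)"
      unfolding Cons_iff by blast
    then show ?case
      using Cons.IH[of "Num (f (out_label r u))"]
      by (cases "f (out_label r u) = r") (auto intro: reaches.intros)
  qed
  show ?thesis
  proof
    assume T: "rooted_in_tree ?G (Num r)"
    show ?R
    proof
      fix i assume "i \<in> {1..n}"
      then obtain u where "u \<in> vertices - {Num r}" "i = out_label r u"
        using out_labelE[OF r] by blast
      then show "reaches r (block_label r) f i"
        using T reach by (auto simp: rooted_in_tree_def)
    qed
  next
    assume R: ?R
    have "\<exists>p. awalk u p (Num r)" if u: "u \<in> vertices" for u
    proof (cases "u = Num r")
      case True
      then show ?thesis using r by (metis Nil_iff Num_in_vertices)
    next
      case False
      then have "out_label r u \<in> {1..n}" using u out_label_image[OF r] by blast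
      then show ?thesis using R walk False u by blast
    qed
    then have "\<exists>!p. awalk u p (Num r)" if "u \<in> vertices" for u
      using that unique by blast
    then show "rooted_in_tree ?G (Num r)"
      by (simp add: rooted_in_tree_def r fin_digraph_axioms)
  qed
qed

end

text \<open>An edge leaving the root would give a walk to the root besides the empty one, and two
  edges leaving \<open>v\<close> would give two walks from \<open>v\<close>.\<close>

lemma out_degree_rooted_in_tree:
  assumes "rooted_in_tree G t"
  shows "out_degree G t = 0" "v \<in> verts G \<Longrightarrow> v \<noteq> t \<Longrightarrow> out_degree G v = 1"
proof -
  interpret fin_digraph G using assms by (simp add: rooted_in_tree_def)
  have t: "t \<in> verts G"
    using assms by (simp add: rooted_in_tree_def)
  have ex1: "\<exists>!p. awalk v p t" if "v \<in> verts G" for v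
    using assms that unfolding rooted_in_tree_def by blast
  have walk: "\<exists>p. awalk v p t" if "v \<in> verts G" for v
    using ex1[OF that] by blast
  have unique: "p = q" if "awalk v p t" "awalk v q t" for v p q
    using ex1[OF awalk_hd_in_verts[OF that(1)]] that by blast
  have Cons: "\<exists>p. awalk (tail G e) (e # p) t" if "e \<in> arcs G" for e
    using walk[OF head_in_verts[OF that]] that by (auto simp: awalk_Cons_iff)
  have "e \<notin> out_arcs G t" for e
    using Cons[of e] unique[of t "[]"] t by (metis awalk_Nil_iff in_out_arcs_conv list.distinct(1))
  then have "out_arcs G t = {}" by blast
  then show "out_degree G t = 0" by (simp add: out_degree_def)
  assume v: "v \<in> verts G" "v \<noteq> t"
  then obtain e p where "awalk v (e # p) t"
    using walk by (metis awalk_Nil_iff list.exhaust)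
  then have e: "e \<in> out_arcs G v" by (simp add: awalk_Cons_iff)
  have "e' = e" if "e' \<in> out_arcs G v" for e'
    using Cons[of e] Cons[of e'] e that unique by (metis in_out_arcs_conv list.inject)
  with e have "out_arcs G v = {e}" by blast
  then show "out_degree G v = 1" by (simp add: out_degree_def)
qed

context label_multiplicities
begin

text \<open>There are \<open>N\<close> edges from integer vertices and one for each element of
  \<open>singles\<close>; splitting \<open>{1..n}\<close> by multiplicity gives the number in
  \<open>UT\<close>.\<close>

lemma card_arcs_if_edge_label_cond:
  assumes "edge_label_cond n m G"
  shows "card (arcs G) = total_mult n m - card {i \<in> {1..n}. m i > 1}"
proof -
  have "image_mset edge_label (mset_set (arcs G)) = num_labels + mset_set singles"
    using assms unfolding edge_label_cond_def all_labels_eq by blast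
  then have "card (arcs G) = N + card singles"
    using size_image_mset[of edge_label "mset_set (arcs G)"] by simp
  moreover have "card {1..n} = card singles + card {i \<in> {1..n}. m i > 1}"
  proof -
    have "{1..n} = singles \<union> {i \<in> {1..n}. m i > 1}"
      using m_pos by (force simp: singles_def)
    moreover have "singles \<inter> {i \<in> {1..n}. m i > 1} = {}"
      by (auto simp: singles_def)
    ultimately show ?thesis
      using card_Un_disjoint[of singles "{i \<in> {1..n}. m i > 1}"]
      by (metis finite_Un finite_atLeastAtMost)
  qed
  moreover have "total_mult n m \<ge> (\<Sum>i\<in>{1..n}. 1)"
    unfolding total_mult_def by (rule sum_mono) (rule m_pos)
  ultimately show ?thesis by (simp add: N_def)
qed

section \<open>Trees, graphs and set partitions in terms of maps\<close>

abbreviation parent_maps :: "(nat \<Rightarrow> nat) set" where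
  "parent_maps \<equiv> {1..n} \<rightarrow>\<^sub>E {0..N}"

definition rooted_trees :: "(nat \<times> (nat \<Rightarrow> nat)) set" where
  "rooted_trees = (SIGMA r:{0..N}.
     {f \<in> parent_maps. \<forall>i\<in>{1..n}. reaches r (block_label r) f i})"

lemma bij_betw_label_graph_UG: "bij_betw (label_graph 0) parent_maps (UG n m)"
proof -
  have "UG n m = {G. rooted_at 0 G}"
    by (auto simp: UG_def rooted_at_def)
  also have "\<dots> = label_graph 0 ` parent_maps"
  proof (intro equalityI subsetI)
    fix G assume "G \<in> {G. rooted_at 0 G}"
    then show "G \<in> label_graph 0 ` parent_maps"
      using label_graph_if_rooted_at[of 0 G] by blast
  next
    fix G assume "G \<in> label_graph 0 ` parent_maps"
    then obtain f where "f \<in> {1..n} \<rightarrow> {0..N}" "G = label_graph 0 f"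
      by (auto simp: PiE_iff)
    then show "G \<in> {G. rooted_at 0 G}"
      using rooted_at_label_graph[of 0 f] by simp
  qed
  finally show ?thesis
    using label_graph_inject[of 0 0] by (auto simp: bij_betw_def inj_on_def PiE_iff)
qed

text \<open>A symbol cannot be the root, since the symbol condition gives it an outgoing
  edge.\<close>

lemma UT_rooted_at:
  assumes "T \<in> UT n m"
  obtains r where "r \<le> N" "rooted_at r T" "rooted_in_tree T (Num r)"
proof -
  obtain t where t: "rooted_in_tree T t" and T: "labeled_digraph T" "labeling_conds n m T"
    using assms by (auto simp: UT_def)
  interpret fin_digraph T using t by (simp add: rooted_in_tree_def)
  have V: "verts T = vertices" and sym: "symbol_cond n m T"
    using T(2) by (auto simp: labeling_conds_def vertex_label_cond_iff)
  have "out_arcs T t = {}"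
    using out_degree_rooted_in_tree(1)[OF t] by (simp add: out_degree_def finite_out_arcs)
  moreover have "out_arcs T (Sym i) \<noteq> {}" if "i \<in> singles" for i
  proof -
    have "i \<in> {1..n}" "m i = 1" using that by (auto simp: singles_def)
    then show ?thesis
      using sym that unfolding symbol_cond_def V by (metis Sym_in_vertices empty_iff)
  qed
  moreover have "t \<in> vertices" using t V by (simp add: rooted_in_tree_def)
  ultimately obtain r where r: "t = Num r" "r \<le> N"
    by (cases t) auto
  moreover have "rooted_at r T"
    using T out_degree_rooted_in_tree[OF t] r by (simp add: rooted_at_def)
  ultimately show ?thesis using that t by blast
qed

lemma bij_betw_label_graph_UT:
  "bij_betw (\<lambda>(r, f). label_graph r f) rooted_trees (UT n m)"
  unfolding bij_betw_def
proof (intro conjI equalityI subsetI)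
  show "inj_on (\<lambda>(r, f). label_graph r f) rooted_trees"
    using label_graph_inject by (auto simp: inj_on_def rooted_trees_def PiE_iff)
next
  fix T assume "T \<in> (\<lambda>(r, f). label_graph r f) ` rooted_trees"
  then obtain r f where T: "T = label_graph r f" "r \<le> N" "f \<in> {1..n} \<rightarrow> {0..N}"
      "\<forall>i\<in>{1..n}. reaches r (block_label r) f i"
    by (auto simp: rooted_trees_def PiE_iff)
  then have "rooted_in_tree T (Num r)" "rooted_at r T"
    using rooted_in_tree_label_graph_iff rooted_at_label_graph by blast+
  then show "T \<in> UT n m"
    using card_arcs_if_edge_label_cond by (auto simp: UT_def rooted_at_def labeling_conds_def)
next
  fix T assume "T \<in> UT n m"
  then obtain r where r: "r \<le> N" "rooted_at r T" "rooted_in_tree T (Num r)"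
    by (rule UT_rooted_at)
  obtain f where f: "f \<in> parent_maps" "T = label_graph r f"
    using label_graph_if_rooted_at[OF r(2,1)] .
  then have "\<forall>i\<in>{1..n}. reaches r (block_label r) f i"
    using rooted_in_tree_label_graph_iff[of r f] r by (auto simp: PiE_iff)
  then have "(r, f) \<in> rooted_trees"
    using f r by (auto simp: rooted_trees_def)
  then show "T \<in> (\<lambda>(r, f). label_graph r f) ` rooted_trees"
    using f(2) by force
qed

lemma parent_maps_with_values:
  assumes "set_mset c \<subseteq> {0..N}"
  shows "{f \<in> parent_maps. image_mset f (mset_set {1..n}) = c} = funs_with_values {1..n} c"
proof (intro equalityI subsetI)
  fix f assume f: "f \<in> funs_with_values {1..n} c"
  then have "f \<in> {1..n} \<rightarrow> {0..N}"
    using funs_with_values_in[OF _ f] assms by blast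
  with f show "f \<in> {f \<in> parent_maps. image_mset f (mset_set {1..n}) = c}"
    by (simp add: funs_with_values_def PiE_def)
qed (simp add: funs_with_values_def PiE_def)

text \<open>Grouped by root, the trees are arborescences on the blocks of
  \<open>block_label r\<close>.\<close>

lemma card_rooted_trees_with_values:
  "card {a \<in> rooted_trees. image_mset (snd a) (mset_set {1..n}) = c} =
    card {f \<in> parent_maps. image_mset f (mset_set {1..n}) = c}"
proof (cases "set_mset c \<subseteq> {0..N} \<and> size c = n")
  case False
  \<comment> \<open>Every parent map has \<open>n\<close> values in \<open>{0..N}\<close>, so both
    sets are empty here.\<close>
  have "set_mset c \<subseteq> {0..N} \<and> size c = n"
    if "f \<in> parent_maps" "image_mset f (mset_set {1..n}) = c" for f
    using that by (auto simp: PiE_iff)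
  then have "{f \<in> parent_maps. image_mset f (mset_set {1..n}) = c} = {}"
      "{a \<in> rooted_trees. image_mset (snd a) (mset_set {1..n}) = c} = {}"
    using False by (auto simp: rooted_trees_def)
  then show ?thesis by (metis card.empty)
next
  case True
  have "{a \<in> rooted_trees. image_mset (snd a) (mset_set {1..n}) = c} =
      (SIGMA r:{0..N}. arborescences r (block_label r) {1..n} c)"
    unfolding arborescences_def parent_maps_with_values[OF conjunct1[OF True], symmetric]
    by (auto simp: rooted_trees_def)
  then have "card {a \<in> rooted_trees. image_mset (snd a) (mset_set {1..n}) = c} =
      (\<Sum>r\<in>{0..N}. card (arborescences r (block_label r) {1..n} c))"
    by (simp add: arborescences_def finite_funs_with_values)
  also have "\<dots> = card (funs_with_values {1..n} c)"
  proof (cases "n = 0")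
    case True
    \<comment> \<open>Without labels the only possible root is \<open>0\<close>, and both sides
      count the same maps.\<close>
    have "N = 0" unfolding N_def total_mult_def using True by simp
    with True show ?thesis by (simp add: arborescences_def)
  next
    case False
    show ?thesis
    proof (rule sum_card_arborescences)
      show "v = r \<or> block_label r v \<in> {1..n}" if "r \<in> {0..N}" "v \<in># c" for r v
        using that True block_label_image[of r] by fastforce
    qed (use True False in auto)
  qed
  finally show ?thesis
    unfolding parent_maps_with_values[OF conjunct1[OF True]] .
qed

definition fibres :: "(nat \<Rightarrow> nat) \<Rightarrow> nat set list" where
  "fibres f = map (\<lambda>j. {i \<in> {1..n}. f i = j}) [0..<N + 1]"

lemma nth_fibres: "j \<le> N \<Longrightarrow> fibres f ! j = {i \<in> {1..n}. f i = j}"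
  by (simp add: fibres_def del: upt_Suc)

text \<open>The inverse sends each integer to the index of its block; indices that are not values
  give the empty blocks.\<close>

lemma bij_betw_fibres: "bij_betw fibres parent_maps (UB n (N + 1))"
  unfolding bij_betw_def
proof (intro conjI equalityI subsetI)
  show "inj_on fibres parent_maps"
  proof (rule inj_onI)
    fix f g assume fg: "f \<in> parent_maps" "g \<in> parent_maps" "fibres f = fibres g"
    show "f = g"
    proof (rule PiE_ext[OF fg(1,2)])
      fix i assume i: "i \<in> {1..n}"
      then have "f i \<le> N" using fg(1) by (auto simp: PiE_iff)
      then have "i \<in> fibres f ! f i" using i by (simp add: nth_fibres)
      then show "f i = g i" using \<open>f i \<le> N\<close> fg(3) by (simp add: nth_fibres)
    qed
  qed
next
  fix bs assume "bs \<in> fibres ` parent_maps"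
  then obtain f where "f \<in> parent_maps" "bs = fibres f" by blast
  then show "bs \<in> UB n (N + 1)"
    by (auto simp: UB_def nth_fibres less_Suc_eq_le PiE_iff) (simp add: fibres_def)
next
  fix bs assume "bs \<in> UB n (N + 1)"
  then have len: "length bs = N + 1" and Un: "(\<Union>j<N + 1. bs ! j) = {1..n}"
    and disj: "\<And>i j. i < N + 1 \<Longrightarrow> j < N + 1 \<Longrightarrow> i \<noteq> j \<Longrightarrow> bs ! i \<inter> bs ! j = {}"
    by (auto simp: UB_def)
  have "\<exists>j<N + 1. i \<in> bs ! j" if "i \<in> {1..n}" for i
    using that unfolding Un[symmetric] by blast
  then obtain g where g: "\<And>i. i \<in> {1..n} \<Longrightarrow> g i < N + 1" "\<And>i. i \<in> {1..n} \<Longrightarrow> i \<in> bs ! g i"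
    by metis
  have "fibres (restrict g {1..n}) = bs"
  proof (rule nth_equalityI)
    fix j assume "j < length (fibres (restrict g {1..n}))"
    then have j: "j < N + 1" by (simp add: fibres_def)
    have "i \<in> bs ! j \<longleftrightarrow> g i = j" if "i \<in> {1..n}" for i
      using g[OF that] disj[of "g i" j] j by blast
    moreover have "bs ! j \<subseteq> {1..n}" using Un j by blast
    ultimately show "fibres (restrict g {1..n}) ! j = bs ! j"
      using j by (auto simp: nth_fibres)
  qed (simp add: fibres_def len)
  moreover have "restrict g {1..n} \<in> parent_maps"
    using g(1) by (auto simp: less_Suc_eq_le)
  ultimately show "bs \<in> fibres ` parent_maps" by blast
qed

end

theorem theorem3p2:
  fixes n :: nat and m :: "nat \<Rightarrow> nat"
  assumes "\<And>i. i \<in> {1..n} \<Longrightarrow> m i \<ge> 1"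
  shows "\<exists>\<psi>\<^sub>1 \<psi>\<^sub>2.
    bij_betw \<psi>\<^sub>1 (UT n m) (UG n m) \<and>
    bij_betw \<psi>\<^sub>2 (UG n m) (UB n (total_mult n m - n + 1)) \<and>
    (\<forall>T\<in>UT n m. \<forall>i\<in>{0..total_mult n m - n}.
       num_in_labels T (Num i) = num_in_labels (\<psi>\<^sub>1 T) (Num i) \<and>
       num_in_labels (\<psi>\<^sub>1 T) (Num i) = card (\<psi>\<^sub>2 (\<psi>\<^sub>1 T) ! i))"
proof -
  interpret label_multiplicities n m by standard (rule assms)
  let ?t = "\<lambda>(r, f). label_graph r f"
  let ?values = "\<lambda>f. image_mset f (mset_set {1..n})"
  have fin: "finite parent_maps" by (rule finite_PiE) auto
  then have "finite rooted_trees" by (auto simp: rooted_trees_def)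
  then obtain h where h: "bij_betw h rooted_trees parent_maps"
      and same_values: "\<And>a. a \<in> rooted_trees \<Longrightarrow> ?values (h a) = ?values (snd a)"
    using bij_betw_of_card_fibres[OF _ fin, of rooted_trees "\<lambda>a. ?values (snd a)" ?values]
      card_rooted_trees_with_values by metis
  \<comment> \<open>A tree is read back as its pair; \<open>h\<close> trades the pair for a map with
    the same values, and the graph of this map has root \<open>0\<close>.\<close>
  define \<psi>\<^sub>1 where "\<psi>\<^sub>1 = label_graph 0 \<circ> (h \<circ> inv_into rooted_trees ?t)"
  define \<psi>\<^sub>2 where "\<psi>\<^sub>2 = fibres \<circ> inv_into parent_maps (label_graph 0)"
  have "bij_betw \<psi>\<^sub>1 (UT n m) (UG n m)"
    unfolding \<psi>\<^sub>1_def
    by (rule bij_betw_trans[OF bij_betw_trans[OF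
          bij_betw_inv_into[OF bij_betw_label_graph_UT] h] bij_betw_label_graph_UG])
  moreover have "bij_betw \<psi>\<^sub>2 (UG n m) (UB n (total_mult n m - n + 1))"
    unfolding \<psi>\<^sub>2_def N_def[symmetric]
    by (rule bij_betw_trans[OF bij_betw_inv_into[OF bij_betw_label_graph_UG] bij_betw_fibres])
  moreover have "num_in_labels T (Num i) = num_in_labels (\<psi>\<^sub>1 T) (Num i) \<and>
      num_in_labels (\<psi>\<^sub>1 T) (Num i) = card (\<psi>\<^sub>2 (\<psi>\<^sub>1 T) ! i)"
    if T: "T \<in> UT n m" and i: "i \<in> {0..total_mult n m - n}" for T i
  proof -
    define a where "a = inv_into rooted_trees ?t T"
    have a: "a \<in> rooted_trees" "T = label_graph (fst a) (snd a)"
      using bij_betwE[OF bij_betw_inv_into[OF bij_betw_label_graph_UT]] T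
        bij_betw_inv_into_right[OF bij_betw_label_graph_UT T]
      by (auto simp: a_def case_prod_unfold)
    have ha: "h a \<in> parent_maps" using bij_betwE[OF h] a(1) by blast
    have \<psi>: "\<psi>\<^sub>1 T = label_graph 0 (h a)" "\<psi>\<^sub>2 (\<psi>\<^sub>1 T) = fibres (h a)"
      using bij_betw_inv_into_left[OF bij_betw_label_graph_UG ha]
      by (simp_all add: \<psi>\<^sub>1_def \<psi>\<^sub>2_def a_def)
    \<comment> \<open>The multiplicity of \<open>i\<close> in the common multiset of values is the
      size of the fibre over \<open>i\<close>.\<close>
    have "card {l \<in> {1..n}. snd a l = i} = card {l \<in> {1..n}. h a l = i}"
      using arg_cong[OF same_values[OF a(1)], of "\<lambda>c. count c i"]
      by (simp add: count_image_mset_eq_card_vimage)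
    moreover have "fst a \<le> N" using a(1) by (auto simp: rooted_trees_def)
    moreover have "i \<le> N" using i by (simp add: N_def)
    ultimately show ?thesis
      unfolding \<psi>(2) unfolding \<psi>(1) by (subst a(2)) (simp add: num_in_labels_label_graph nth_fibres)
  qed
  ultimately show ?thesis by blast
qed

end
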